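(* Let $f:[0,\infty)\to\mathbb{R}$ be a superquadratic function and let $\varphi:[0,\infty)\to\mathbb{R}$ be a function such that $f(y)\ge f(x)+\varphi(x)(y-x)+f(|y-x|)$ for all $x,y\ge0$. Let $x_1,\dots,x_n\ge 0$ and let $(a_1,\dots,a_n)$ be a nonnegative $n$-tuple with $A_n=\sum_{i=1}^n a_i>0$. Let $\overline{x}=\frac{1}{A_n}\sum_{i=1}^n a_ix_i$ and $\widehat{x}_i=(1-\lambda_i)\overline{x}+\lambda_ix_i$ with $\lambda_i\in[0,1]$, $i=1,\dots,n$. Then $$0\le\left|\frac{1}{A_n}\sum_{i=1}^n a_i\left|f(x_i)-f(\widehat{x}_i)-f\big((1-\lambda_i)|\overline{x}-x_i|\big)\right|-\frac{1}{A_n}\sum_{i=1}^n a_i(1-\lambda_i)|\varphi(\widehat{x}_i)|\,|\overline{x}-x_i|\right|$$ $$\le\frac{1}{A_n}\sum_{i=1}^n a_if(x_i)-\frac{1}{A_n}\sum_{i=1}^n a_if(\widehat{x}_i)-\frac{1}{A_n}\sum_{i=1}^n a_i(1-\lambda_i)\varphi(\widehat{x}_i)(\overline{x}-x_i)-\sum_{i=1}^n a_if\big((1-\lambda_i)|\overline{x}-x_i|\big).$$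
   Context: A function $f:[0,\infty)\to\mathbb{R}$ is superquadratic if for every $x\ge0$ there is a constant $C_x\in\mathbb{R}$ such that $f(y)\ge f(x)+C_x(y-x)+f(|y-x|)$ for all $y\ge0$; thus $\varphi(x)=C_x$ is a choice of such constants.
   Formalization: The printed upper bound is false (f(t)=t², φ(t)=2t, x=(0,2)); in the formal statement the φ term has (x_i − x̄) in place of (x̄ − x_i), and the last sum carries the missing factor 1/A_n. *)

theory Defs
  imports Complex_Main
begin

(* Functions on [0,\<infinity>) are modelled as total functions real => real whose values at
   negative arguments are never used. *)

definition superquadratic :: "(real \<Rightarrow> real) \<Rightarrow> bool" where
  "superquadratic f \<longleftrightarrow>
     (\<forall>x\<ge>0. \<exists>C. \<forall>y\<ge>0. f y \<ge> f x + C * (y - x) + f \<bar>y - x\<bar>)"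

(* Pitfall in the refined Jensen inequality: its upper bound is the A-average of
     f (x i) - f (xhat i) - phi (xhat i) * (x i - xhat i) - f \<bar>x i - xhat i\<bar>,
   where x i - xhat i = (1 - lam i) * (x i - xbar).  The printed version of the bound has
   xbar - x i in place of x i - xbar in the phi term and omits the factor 1 / A in the last
   sum.  Either slip alone makes it fail, for f t = t^2, phi t = 2 * t, x = (0, 2), with
   a = (1/2, 1/2), lam = (0, 1) for the sign and a = (1, 1), lam = (0, 0) for the factor. *)

end

theory Submission imports Defs begin

text \<open>
  With \<open>u i = f (x i) - f (xhat i) - f \<bar>x i - xhat i\<bar>\<close> and
  \<open>v i = \<phi> (xhat i) * (x i - xhat i)\<close>, superquadraticity at \<open>xhat i\<close> says
  \<open>v i \<le> u i\<close>, so the reverse triangle inequality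
  \<open>\<bar>\<bar>u i\<bar> - \<bar>v i\<bar>\<bar> \<le> u i - v i\<close> can be averaged with the weights \<open>a i / A\<close>.
\<close>

lemma abs_weighted_sum_diff_abs_le:
  fixes w u v :: "'i \<Rightarrow> real"
  assumes "\<And>i. i \<in> I \<Longrightarrow> 0 \<le> w i" and "\<And>i. i \<in> I \<Longrightarrow> v i \<le> u i"
  shows "\<bar>(\<Sum>i\<in>I. w i * \<bar>u i\<bar>) - (\<Sum>i\<in>I. w i * \<bar>v i\<bar>)\<bar> \<le> (\<Sum>i\<in>I. w i * (u i - v i))"
proof -
  \<comment> \<open>The two sums are merged into one, so that the reverse triangle inequality
    applies term by term; the final simplification splits them again.\<close>
  have "\<bar>\<Sum>i\<in>I. w i * (\<bar>u i\<bar> - \<bar>v i\<bar>)\<bar> \<le> (\<Sum>i\<in>I. \<bar>w i * (\<bar>u i\<bar> - \<bar>v i\<bar>)\<bar>)"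
    by (rule sum_abs)
  also have "\<dots> \<le> (\<Sum>i\<in>I. w i * (u i - v i))"
  proof (rule sum_mono)
    fix i assume i: "i \<in> I"
    have "\<bar>\<bar>u i\<bar> - \<bar>v i\<bar>\<bar> \<le> u i - v i"
      using assms(2)[OF i] by linarith
    then show "\<bar>w i * (\<bar>u i\<bar> - \<bar>v i\<bar>)\<bar> \<le> w i * (u i - v i)"
      using assms(1)[OF i] by (simp add: abs_mult mult_left_mono)
  qed
  finally show ?thesis
    by (simp add: right_diff_distrib sum_subtractf)
qed

theorem theorem16:
  fixes f \<phi> :: "real \<Rightarrow> real"
    and n :: nat
    and x a lam xhat :: "nat \<Rightarrow> real"
    and A xbar :: real
  assumes "superquadratic f"
    and "\<And>s t. s \<ge> 0 \<Longrightarrow> t \<ge> 0 \<Longrightarrow> f t \<ge> f s + \<phi> s * (t - s) + f \<bar>t - s\<bar>"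
    and "\<And>i. i \<in> {1..n} \<Longrightarrow> x i \<ge> 0"
    and "\<And>i. i \<in> {1..n} \<Longrightarrow> a i \<ge> 0"
    and "A = (\<Sum>i=1..n. a i)" and "A > 0"
    and "xbar = 1 / A * (\<Sum>i=1..n. a i * x i)"
    and "\<And>i. i \<in> {1..n} \<Longrightarrow> lam i \<in> {0..1}"
    and "\<And>i. i \<in> {1..n} \<Longrightarrow> xhat i = (1 - lam i) * xbar + lam i * x i"
  shows
    "0 \<le> \<bar>1 / A * (\<Sum>i=1..n. a i * \<bar>f (x i) - f (xhat i) - f ((1 - lam i) * \<bar>xbar - x i\<bar>)\<bar>)
          - 1 / A * (\<Sum>i=1..n. a i * (1 - lam i) * \<bar>\<phi> (xhat i)\<bar> * \<bar>xbar - x i\<bar>)\<bar>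
     \<and> \<bar>1 / A * (\<Sum>i=1..n. a i * \<bar>f (x i) - f (xhat i) - f ((1 - lam i) * \<bar>xbar - x i\<bar>)\<bar>)
          - 1 / A * (\<Sum>i=1..n. a i * (1 - lam i) * \<bar>\<phi> (xhat i)\<bar> * \<bar>xbar - x i\<bar>)\<bar>
       \<le> 1 / A * (\<Sum>i=1..n. a i * f (x i))
          - 1 / A * (\<Sum>i=1..n. a i * f (xhat i))
          - 1 / A * (\<Sum>i=1..n. a i * (1 - lam i) * \<phi> (xhat i) * (x i - xbar))
          - 1 / A * (\<Sum>i=1..n. a i * f ((1 - lam i) * \<bar>xbar - x i\<bar>))"
proof (intro conjI abs_ge_zero)
  define u where "u i = f (x i) - f (xhat i) - f ((1 - lam i) * \<bar>xbar - x i\<bar>)" for i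
  define v where "v i = (1 - lam i) * \<phi> (xhat i) * (x i - xbar)" for i
  \<comment> \<open>The inequality for \<open>f\<close> is available only at nonnegative points;
    \<open>xhat i\<close> qualifies as a convex combination of \<open>xbar\<close> and
    \<open>x i\<close>, once \<open>xbar\<close> is nonnegative.\<close>
  have "0 \<le> (\<Sum>i=1..n. a i * x i)"
    using assms(3,4) by (intro sum_nonneg mult_nonneg_nonneg)
  then have xbar: "0 \<le> xbar"
    using assms(6,7) by simp
  have lam: "0 \<le> lam i" "lam i \<le> 1" if "i \<in> {1..n}" for i
    using assms(8)[OF that] by simp_all
  have vu: "v i \<le> u i" if i: "i \<in> {1..n}" for i
  proof -
    have "0 \<le> xhat i"
      using assms(3,9)[OF i] lam[OF i] xbar by simp
    \<comment> \<open>This identity turns the increment from \<open>xhat i\<close> to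
      \<open>x i\<close> into the factor in \<open>v i\<close> and fixes its sign as
      \<open>x i - xbar\<close>.\<close>
    moreover have diff: "x i - xhat i = (1 - lam i) * (x i - xbar)"
      using assms(9)[OF i] by (simp add: algebra_simps)
    moreover have "\<bar>x i - xhat i\<bar> = (1 - lam i) * \<bar>xbar - x i\<bar>"
      using lam[OF i] by (simp add: diff abs_mult abs_minus_commute)
    ultimately show ?thesis
      using assms(2)[of "xhat i" "x i"] assms(3)[OF i] by (simp add: u_def v_def mult_ac)
  qed
  \<comment> \<open>Since \<open>1 - lam i\<close> is nonnegative it passes through the absolute
    value, which also hides the orientation of \<open>xbar - x i\<close>.\<close>
  have absv: "(\<Sum>i=1..n. a i * (1 - lam i) * \<bar>\<phi> (xhat i)\<bar> * \<bar>xbar - x i\<bar>)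
      = (\<Sum>i=1..n. a i * \<bar>v i\<bar>)"
    using lam by (intro sum.cong) (simp_all add: v_def abs_mult abs_minus_commute)
  have rhs: "(\<Sum>i=1..n. a i * (u i - v i))
      = (\<Sum>i=1..n. a i * f (x i)) - (\<Sum>i=1..n. a i * f (xhat i))
        - (\<Sum>i=1..n. a i * (1 - lam i) * \<phi> (xhat i) * (x i - xbar))
        - (\<Sum>i=1..n. a i * f ((1 - lam i) * \<bar>xbar - x i\<bar>))"
    unfolding sum_subtractf[symmetric]
    by (intro sum.cong) (simp_all add: u_def v_def algebra_simps)
  \<comment> \<open>The lemma is used with the raw weights \<open>a i\<close>; the positive factor
    \<open>1 / A\<close> is multiplied on afterwards and then moved inside the absolute
    value.\<close>
  have "1 / A * \<bar>(\<Sum>i=1..n. a i * \<bar>u i\<bar>) - (\<Sum>i=1..n. a i * \<bar>v i\<bar>)\<bar>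
      \<le> 1 / A * (\<Sum>i=1..n. a i * (u i - v i))"
    using assms(4,6) vu by (intro mult_left_mono abs_weighted_sum_diff_abs_le) auto
  then have "\<bar>1 / A * (\<Sum>i=1..n. a i * \<bar>u i\<bar>) - 1 / A * (\<Sum>i=1..n. a i * \<bar>v i\<bar>)\<bar>
      \<le> 1 / A * (\<Sum>i=1..n. a i * (u i - v i))"
    using assms(6) by (simp add: right_diff_distrib[symmetric] diff_divide_distrib[symmetric])
  \<comment> \<open>The order of unfolding matters: \<open>rhs\<close> matches only while
    \<open>u\<close> is still folded, so \<open>u_def\<close> comes after it.\<close>
  then show "\<bar>1 / A * (\<Sum>i=1..n. a i * \<bar>f (x i) - f (xhat i) - f ((1 - lam i) * \<bar>xbar - x i\<bar>)\<bar>)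
      - 1 / A * (\<Sum>i=1..n. a i * (1 - lam i) * \<bar>\<phi> (xhat i)\<bar> * \<bar>xbar - x i\<bar>)\<bar>
    \<le> 1 / A * (\<Sum>i=1..n. a i * f (x i))
      - 1 / A * (\<Sum>i=1..n. a i * f (xhat i))
      - 1 / A * (\<Sum>i=1..n. a i * (1 - lam i) * \<phi> (xhat i) * (x i - xbar))
      - 1 / A * (\<Sum>i=1..n. a i * f ((1 - lam i) * \<bar>xbar - x i\<bar>))"
    unfolding absv rhs unfolding u_def right_diff_distrib[of "1 / A"] .
qed

end
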